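(* $\mathbf{ACT}_\omega$ is weakly complete with respect to finite SCL-models with non-standard $\bot$: every sequent that is true in all SCL-models with non-standard $\bot$ whose underlying algebra (the upper cone $\{M\in\mathcal B(L)\mid Z\subseteq M\}$) is finite is derivable in $\mathbf{ACT}_\omega$ without hypotheses.
   Context: Formulae are built from countably many variables and constants $\top,\bot,\mathbf 1$ using $\backslash,/,\cdot,\wedge,\vee,{}^*$. Sequents $A_1,\dots,A_n\to B$, $n\ge0$. Rules of $\mathbf{ACT}_\omega$: $A\to A$; $\Gamma,\bot,\Delta\to C$; $\Pi\to\top$; $\to\mathbf 1$; from $\Gamma,\Delta\to C$ infer $\Gamma,\mathbf 1,\Delta\to C$; from $\Gamma,A,B,\Delta\to C$ infer $\Gamma,A\cdot B,\Delta\to C$; from $\Gamma\to A$, $\Delta\to B$ infer $\Gamma,\Delta\to A\cdot B$; from $\Pi\to A$ and $\Gamma,B,\Delta\to C$ infer $\Gamma,\Pi,A\backslash B,\Delta\to C$ and $\Gamma,B/A,\Pi,\Delta\to C$; from $A,\Pi\to B$ infer $\Pi\to A\backslash B$; from $\Pi,A\to B$ infer $\Pi\to B/A$; the two $\wedge$-left rules, $\wedge$-right, $\vee$-left, the two $\vee$-right rules (standard lattice rules); Cut; from $\Gamma,A^n,\Delta\to C$ for all $n\ge0$ infer $\Gamma,A^*,\Delta\to C$; for $n\ge0$ from $\Pi_1\to A,\dots,\Pi_n\to A$ infer $\Pi_1,\dots,\Pi_n\to A^*$. Derivations may be infinite but well-founded. SCL-models with non-standard $\bot$: alphabet $\Sigma$,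 $L\subseteq\Sigma^*$; $M^{\rhd}=\{(x,y)\mid\forall w\in M\;xwy\in L\}$, $C^{\lhd}=\{v\in\Sigma^*\mid\forall(x,y)\in C\;xvy\in L\}$; $\mathcal B(L)=\{M\mid M=M^{\rhd\lhd}\}$ with $M_1\circ M_2=(M_1M_2)^{\rhd\lhd}$, $\backslash$, $/$ as language quotients $\{u\mid\forall v\in M_1\;vu\in M_2\}$, $\{u\mid\forall v\in M_1\;uv\in M_2\}$, $\cap$, $M_1\sqcup M_2=(M_1\cup M_2)^{\rhd\lhd}$, $M^{\circledast}=(M^* )^{\rhd\lhd}$, top $\Sigma^*$, unit $\{\varepsilon\}^{\rhd\lhd}$. $Z\in\mathcal B(L)$ with $\varepsilon\in Z$ is a local zero if $(MZ)^{\rhd\lhd}=(ZM)^{\rhd\lhd}=Z$ for all closed $M\supseteq Z$; the model interprets formulae homomorphically in $\{M\in\mathcal B(L)\mid Z\subseteq M\}$ with $\bot\mapsto Z$. $A_1,\dots,A_n\to B$ ($n\ge1$) is true if $\alpha(A_1)\circ\dots\circ\alpha(A_n)\subseteq\alpha(B)$; $\to B$ is true if $\varepsilon\in\alpha(B)$.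
   Formalization: The condition ε∈Z on a local zero is replaced by Z⊆{ε}^{▷◁} (the unit lies in the upper cone); with ε∈Z the cone collapses to the single element Z=Σ*, so the underivable p→q would be true in all models and the claim false. *)

theory Defs
  imports Main
begin

section \<open>Infinitary action logic\<close>

text \<open>\<open>LDiv A B\<close> is A\B and \<open>RDiv B A\<close> is B/A.\<close>

datatype form =
    Var nat
  | Top
  | Bot
  | One
  | LDiv form form
  | RDiv form form
  | Times form form
  | Meet form form
  | Join form form
  | Star form

inductive ACT :: "form list \<Rightarrow> form \<Rightarrow> bool"  (infix "\<turnstile>" 50) where
  ax: "[A] \<turnstile> A"
| botL: "\<Gamma> @ [Bot] @ \<Delta> \<turnstile> C"
| topR: "\<Pi> \<turnstile> Top"
| oneR: "[] \<turnstile> One"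
| oneL: "\<Gamma> @ \<Delta> \<turnstile> C \<Longrightarrow> \<Gamma> @ [One] @ \<Delta> \<turnstile> C"
| timesL: "\<Gamma> @ [A, B] @ \<Delta> \<turnstile> C \<Longrightarrow> \<Gamma> @ [Times A B] @ \<Delta> \<turnstile> C"
| timesR: "\<Gamma> \<turnstile> A \<Longrightarrow> \<Delta> \<turnstile> B \<Longrightarrow> \<Gamma> @ \<Delta> \<turnstile> Times A B"
| ldivL: "\<Pi> \<turnstile> A \<Longrightarrow> \<Gamma> @ [B] @ \<Delta> \<turnstile> C \<Longrightarrow> \<Gamma> @ \<Pi> @ [LDiv A B] @ \<Delta> \<turnstile> C"
| rdivL: "\<Pi> \<turnstile> A \<Longrightarrow> \<Gamma> @ [B] @ \<Delta> \<turnstile> C \<Longrightarrow> \<Gamma> @ [RDiv B A] @ \<Pi> @ \<Delta> \<turnstile> C"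
| ldivR: "[A] @ \<Pi> \<turnstile> B \<Longrightarrow> \<Pi> \<turnstile> LDiv A B"
| rdivR: "\<Pi> @ [A] \<turnstile> B \<Longrightarrow> \<Pi> \<turnstile> RDiv B A"
| meetL1: "\<Gamma> @ [A] @ \<Delta> \<turnstile> C \<Longrightarrow> \<Gamma> @ [Meet A B] @ \<Delta> \<turnstile> C"
| meetL2: "\<Gamma> @ [B] @ \<Delta> \<turnstile> C \<Longrightarrow> \<Gamma> @ [Meet A B] @ \<Delta> \<turnstile> C"
| meetR: "\<Pi> \<turnstile> A \<Longrightarrow> \<Pi> \<turnstile> B \<Longrightarrow> \<Pi> \<turnstile> Meet A B"
| joinL: "\<Gamma> @ [A] @ \<Delta> \<turnstile> C \<Longrightarrow> \<Gamma> @ [B] @ \<Delta> \<turnstile> C \<Longrightarrow> \<Gamma> @ [Join A B] @ \<Delta> \<turnstile> C"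
| joinR1: "\<Pi> \<turnstile> A \<Longrightarrow> \<Pi> \<turnstile> Join A B"
| joinR2: "\<Pi> \<turnstile> B \<Longrightarrow> \<Pi> \<turnstile> Join A B"
| starL: "(\<And>n. \<Gamma> @ replicate n A @ \<Delta> \<turnstile> C) \<Longrightarrow> \<Gamma> @ [Star A] @ \<Delta> \<turnstile> C"
| starR: "(\<forall>\<Pi> \<in> set \<Pi>s. \<Pi> \<turnstile> A) \<Longrightarrow> concat \<Pi>s \<turnstile> Star A"
| cut: "\<Pi> \<turnstile> A \<Longrightarrow> \<Gamma> @ [A] @ \<Delta> \<turnstile> C \<Longrightarrow> \<Gamma> @ \<Pi> @ \<Delta> \<turnstile> C"


section \<open>Syntactic concept lattices\<close>

text \<open>Words over the alphabet \<open>\<Sigma>\<close> are the elements of \<open>lists \<Sigma>\<close>; all closure operators are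
  relative to \<open>\<Sigma>\<close> and the language \<open>L\<close>.\<close>

definition conc :: "'a list set \<Rightarrow> 'a list set \<Rightarrow> 'a list set" where
  "conc M N = {u @ v | u v. u \<in> M \<and> v \<in> N}"

definition kstar :: "'a list set \<Rightarrow> 'a list set" where
  "kstar M = {concat ws | ws. set ws \<subseteq> M}"

definition ctxs :: "'a set \<Rightarrow> 'a list set \<Rightarrow> 'a list set \<Rightarrow> ('a list \<times> 'a list) set" where
  "ctxs \<Sigma> L M = {(x, y). x \<in> lists \<Sigma> \<and> y \<in> lists \<Sigma> \<and> (\<forall>w\<in>M. x @ w @ y \<in> L)}"

definition fillers :: "'a set \<Rightarrow> 'a list set \<Rightarrow> ('a list \<times> 'a list) set \<Rightarrow> 'a list set" where
  "fillers \<Sigma> L C = {v \<in> lists \<Sigma>. \<forall>(x, y)\<in>C. x @ v @ y \<in> L}"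

definition cl :: "'a set \<Rightarrow> 'a list set \<Rightarrow> 'a list set \<Rightarrow> 'a list set" where
  "cl \<Sigma> L M = fillers \<Sigma> L (ctxs \<Sigma> L M)"

definition concepts :: "'a set \<Rightarrow> 'a list set \<Rightarrow> 'a list set set" where
  "concepts \<Sigma> L = {M. M \<subseteq> lists \<Sigma> \<and> M = cl \<Sigma> L M}"

definition fuse :: "'a set \<Rightarrow> 'a list set \<Rightarrow> 'a list set \<Rightarrow> 'a list set \<Rightarrow> 'a list set" where
  "fuse \<Sigma> L M N = cl \<Sigma> L (conc M N)"

definition unit :: "'a set \<Rightarrow> 'a list set \<Rightarrow> 'a list set" where
  "unit \<Sigma> L = cl \<Sigma> L {[]}"

definition lquot :: "'a set \<Rightarrow> 'a list set \<Rightarrow> 'a list set \<Rightarrow> 'a list set" where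
  "lquot \<Sigma> M N = {u \<in> lists \<Sigma>. \<forall>v\<in>M. v @ u \<in> N}"

definition rquot :: "'a set \<Rightarrow> 'a list set \<Rightarrow> 'a list set \<Rightarrow> 'a list set" where
  "rquot \<Sigma> N M = {u \<in> lists \<Sigma>. \<forall>v\<in>M. u @ v \<in> N}"

definition cone :: "'a set \<Rightarrow> 'a list set \<Rightarrow> 'a list set \<Rightarrow> 'a list set set" where
  "cone \<Sigma> L Z = {M \<in> concepts \<Sigma> L. Z \<subseteq> M}"

text \<open>The side condition on \<open>Z\<close> relates it to the empty word by \<open>Z \<subseteq> unit \<Sigma> L\<close>: the unit has
  to belong to the upper cone of \<open>Z\<close>, in which formulae are interpreted. The condition
  \<open>[] \<in> Z\<close>, i.e. \<open>unit \<Sigma> L \<subseteq> Z\<close>, would instead collapse the cone to a single element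
  (lemma \<open>cone_collapse\<close> below) and make every sequent true in the model.\<close>

definition local_zero :: "'a set \<Rightarrow> 'a list set \<Rightarrow> 'a list set \<Rightarrow> bool" where
  "local_zero \<Sigma> L Z \<longleftrightarrow> Z \<in> concepts \<Sigma> L \<and> Z \<subseteq> unit \<Sigma> L \<and>
     (\<forall>M \<in> concepts \<Sigma> L. Z \<subseteq> M \<longrightarrow> cl \<Sigma> L (conc M Z) = Z \<and> cl \<Sigma> L (conc Z M) = Z)"

primrec interp :: "'a set \<Rightarrow> 'a list set \<Rightarrow> 'a list set \<Rightarrow> (nat \<Rightarrow> 'a list set) \<Rightarrow> form \<Rightarrow> 'a list set"
where
  "interp \<Sigma> L Z \<nu> (Var p) = \<nu> p"
| "interp \<Sigma> L Z \<nu> Top = lists \<Sigma>"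
| "interp \<Sigma> L Z \<nu> Bot = Z"
| "interp \<Sigma> L Z \<nu> One = unit \<Sigma> L"
| "interp \<Sigma> L Z \<nu> (LDiv A B) = lquot \<Sigma> (interp \<Sigma> L Z \<nu> A) (interp \<Sigma> L Z \<nu> B)"
| "interp \<Sigma> L Z \<nu> (RDiv B A) = rquot \<Sigma> (interp \<Sigma> L Z \<nu> B) (interp \<Sigma> L Z \<nu> A)"
| "interp \<Sigma> L Z \<nu> (Times A B) = fuse \<Sigma> L (interp \<Sigma> L Z \<nu> A) (interp \<Sigma> L Z \<nu> B)"
| "interp \<Sigma> L Z \<nu> (Meet A B) = interp \<Sigma> L Z \<nu> A \<inter> interp \<Sigma> L Z \<nu> B"
| "interp \<Sigma> L Z \<nu> (Join A B) = cl \<Sigma> L (interp \<Sigma> L Z \<nu> A \<union> interp \<Sigma> L Z \<nu> B)"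
| "interp \<Sigma> L Z \<nu> (Star A) = cl \<Sigma> L (kstar (interp \<Sigma> L Z \<nu> A))"

text \<open>A model consists of \<open>\<Sigma>\<close>, \<open>L\<close>, \<open>Z\<close> and the values \<open>\<nu>\<close> of the variables.\<close>

definition SCL_model :: "'a set \<Rightarrow> 'a list set \<Rightarrow> 'a list set \<Rightarrow> (nat \<Rightarrow> 'a list set) \<Rightarrow> bool" where
  "SCL_model \<Sigma> L Z \<nu> \<longleftrightarrow> L \<subseteq> lists \<Sigma> \<and> local_zero \<Sigma> L Z \<and> (\<forall>p. \<nu> p \<in> cone \<Sigma> L Z)"

fun true_in ::
  "'a set \<Rightarrow> 'a list set \<Rightarrow> 'a list set \<Rightarrow> (nat \<Rightarrow> 'a list set) \<Rightarrow> form list \<Rightarrow> form \<Rightarrow> bool"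
where
  "true_in \<Sigma> L Z \<nu> [] B \<longleftrightarrow> [] \<in> interp \<Sigma> L Z \<nu> B"
| "true_in \<Sigma> L Z \<nu> (A # \<Gamma>) B \<longleftrightarrow>
     foldl (fuse \<Sigma> L) (interp \<Sigma> L Z \<nu> A) (map (interp \<Sigma> L Z \<nu>) \<Gamma>) \<subseteq> interp \<Sigma> L Z \<nu> B"


lemma cone_collapse:
  assumes "local_zero \<Sigma> L Z" "[] \<in> Z"
  shows "cone \<Sigma> L Z = {Z}"
proof -
  have "w \<in> Z" if M: "M \<in> cone \<Sigma> L Z" and w: "w \<in> M" for M w
  proof -
    have "w @ [] \<in> conc M Z"
      unfolding conc_def using w assms(2) by blast
    moreover have "w \<in> lists \<Sigma>"
      using M w by (auto simp: cone_def concepts_def)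
    ultimately have "w \<in> cl \<Sigma> L (conc M Z)"
      by (auto simp: cl_def fillers_def ctxs_def)
    then show ?thesis
      using M assms(1) by (simp add: cone_def local_zero_def)
  qed
  then show ?thesis
    using assms(1) by (auto simp: cone_def local_zero_def)
qed

end

theory Submission
  imports Defs "HOL-Library.Multiset" "HOL-Library.Countable"
begin

text \<open>Call a set \<open>F\<close> of sequents a refutation if every cut-free rule instance with conclusion
  in \<open>F\<close> has a premise in \<open>F\<close>. Every underivable sequent lies in a finite refutation: the multiset
  of its formulae decreases from conclusion to premises, the premises of all rules but the
  left rule for the star range over a finite set, and for the latter rule one underivable premise
  suffices. Let words encode sequents, using two letters for every formula, one for its antecedent
  and one for its succedent occurrences. Let \<open>L\<close> consist of the words that contain a succedent
  letter and do not encode a sequent of \<open>F\<close>, and let \<open>Z\<close> consist of the words fitting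
  into all contexts that contain a succedent letter. Since \<open>F\<close> is finite, members of the
  upper cone of \<open>Z\<close> omit only factors of finitely many words, so the cone is finite. Since \<open>F\<close> is a
  refutation, the value of \<open>A\<close> contains the antecedent letter of \<open>A\<close> and consists of words
  \<open>u\<close> such that \<open>L\<close> contains \<open>u\<close> followed by the succedent letter of \<open>A\<close>.\<close>

section \<open>Finite refutations\<close>

type_synonym seq = "form list \<times> form"

text \<open>Premises are drawn from a parameter set \<open>X\<close>, so that one monotone operator
  serves twice: with \<open>X\<close> the derivable sequents it expresses soundness of the rules,
  with \<open>X\<close> the complement of \<open>F\<close> it expresses refutation.\<close>

inductive rule_step :: "seq set \<Rightarrow> seq \<Rightarrow> bool" for X where
  ax: "rule_step X ([A], A)"
| botL: "rule_step X (\<Gamma> @ [Bot] @ \<Delta>, C)"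
| topR: "rule_step X (\<Pi>, Top)"
| oneR: "rule_step X ([], One)"
| oneL: "(\<Gamma> @ \<Delta>, C) \<in> X \<Longrightarrow> rule_step X (\<Gamma> @ [One] @ \<Delta>, C)"
| timesL: "(\<Gamma> @ [A, B] @ \<Delta>, C) \<in> X \<Longrightarrow> rule_step X (\<Gamma> @ [Times A B] @ \<Delta>, C)"
| timesR: "(\<Gamma>, A) \<in> X \<Longrightarrow> (\<Delta>, B) \<in> X \<Longrightarrow> rule_step X (\<Gamma> @ \<Delta>, Times A B)"
| ldivL: "(\<Pi>, A) \<in> X \<Longrightarrow> (\<Gamma> @ [B] @ \<Delta>, C) \<in> X \<Longrightarrow>
    rule_step X (\<Gamma> @ \<Pi> @ [LDiv A B] @ \<Delta>, C)"
| rdivL: "(\<Pi>, A) \<in> X \<Longrightarrow> (\<Gamma> @ [B] @ \<Delta>, C) \<in> X \<Longrightarrow>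
    rule_step X (\<Gamma> @ [RDiv B A] @ \<Pi> @ \<Delta>, C)"
| ldivR: "([A] @ \<Pi>, B) \<in> X \<Longrightarrow> rule_step X (\<Pi>, LDiv A B)"
| rdivR: "(\<Pi> @ [A], B) \<in> X \<Longrightarrow> rule_step X (\<Pi>, RDiv B A)"
| meetL1: "(\<Gamma> @ [A] @ \<Delta>, C) \<in> X \<Longrightarrow> rule_step X (\<Gamma> @ [Meet A B] @ \<Delta>, C)"
| meetL2: "(\<Gamma> @ [B] @ \<Delta>, C) \<in> X \<Longrightarrow> rule_step X (\<Gamma> @ [Meet A B] @ \<Delta>, C)"
| meetR: "(\<Pi>, A) \<in> X \<Longrightarrow> (\<Pi>, B) \<in> X \<Longrightarrow> rule_step X (\<Pi>, Meet A B)"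
| joinL: "(\<Gamma> @ [A] @ \<Delta>, C) \<in> X \<Longrightarrow> (\<Gamma> @ [B] @ \<Delta>, C) \<in> X \<Longrightarrow>
    rule_step X (\<Gamma> @ [Join A B] @ \<Delta>, C)"
| joinR1: "(\<Pi>, A) \<in> X \<Longrightarrow> rule_step X (\<Pi>, Join A B)"
| joinR2: "(\<Pi>, B) \<in> X \<Longrightarrow> rule_step X (\<Pi>, Join A B)"
| starL: "(\<And>n. (\<Gamma> @ replicate n A @ \<Delta>, C) \<in> X) \<Longrightarrow> rule_step X (\<Gamma> @ [Star A] @ \<Delta>, C)"
| starR: "(\<And>\<Pi>. \<Pi> \<in> set \<Pi>s \<Longrightarrow> (\<Pi>, A) \<in> X) \<Longrightarrow> rule_step X (concat \<Pi>s, Star A)"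

lemma rule_step_mono: "rule_step X S \<Longrightarrow> X \<subseteq> Y \<Longrightarrow> rule_step Y S"
  by (induction rule: rule_step.induct) (blast intro: rule_step.intros)+

lemma rule_step_sound: "rule_step {(\<Gamma>, C). \<Gamma> \<turnstile> C} (\<Gamma>, C) \<Longrightarrow> \<Gamma> \<turnstile> C"
  by (erule rule_step.cases)
    (auto simp only: prod.inject mem_Collect_eq case_prod_conv
      intro: ACT.ax ACT.botL ACT.topR ACT.oneR ACT.oneL ACT.timesL ACT.timesR ACT.ldivL ACT.rdivL
        ACT.ldivR ACT.rdivR ACT.meetL1 ACT.meetL2 ACT.meetR ACT.joinL ACT.joinR1 ACT.joinR2
        ACT.starL ACT.starR)

definition refutation :: "seq set \<Rightarrow> bool" where
  "refutation F \<longleftrightarrow> (\<forall>S\<in>F. \<not> rule_step (- F) S)"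

section \<open>Subformulae and the multiset order on sequents\<close>

primrec subf :: "form \<Rightarrow> form set" where
  "subf (Var p) = {Var p}"
| "subf Top = {Top}"
| "subf Bot = {Bot}"
| "subf One = {One}"
| "subf (LDiv A B) = insert (LDiv A B) (subf A \<union> subf B)"
| "subf (RDiv B A) = insert (RDiv B A) (subf B \<union> subf A)"
| "subf (Times A B) = insert (Times A B) (subf A \<union> subf B)"
| "subf (Meet A B) = insert (Meet A B) (subf A \<union> subf B)"
| "subf (Join A B) = insert (Join A B) (subf A \<union> subf B)"
| "subf (Star A) = insert (Star A) (subf A)"

lemma self_subf [simp]: "A \<in> subf A"
  by (cases A) auto

lemma finite_subf [simp]: "finite (subf A)"
  by (induction A) auto

fun seq_mset :: "seq \<Rightarrow> form multiset" where
  "seq_mset (\<Gamma>, C) = add_mset C (mset \<Gamma>)"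

text \<open>A multiset order is chosen because the left rule for the star replaces one formula by
  arbitrarily many smaller ones.\<close>

definition seq_less :: "(seq \<times> seq) set" where
  "seq_less = inv_image (mult (measure size)) seq_mset"

lemma wf_seq_less: "wf seq_less"
  by (simp add: seq_less_def wf_mult)

text \<open>Here \<open>A\<close> is the principal formula, \<open>K\<close> its replacement,
  \<open>I\<close> the context kept, and \<open>J\<close> the formulae that this premise loses, such
  as those passed to another premise.\<close>

lemma seq_lessI:
  assumes "seq_mset S = I + add_mset A J" "seq_mset T = I + K" "\<And>B. B \<in># K \<Longrightarrow> size B < size A"
  shows "(T, S) \<in> seq_less"
proof -
  have "(I + K, I + add_mset A J) \<in> mult (measure size)"
    by (rule one_step_implies_mult) (use assms(3) in auto)
  then show ?thesis
    using assms by (simp add: seq_less_def)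
qed

text \<open>A finite bound for the premises of all rules but the left rule for the star.\<close>

fun prem_seqs :: "seq \<Rightarrow> seq set" where
  "prem_seqs (\<Gamma>, C) = {(\<Pi>, D). ((\<Pi>, D), (\<Gamma>, C)) \<in> seq_less \<and> length \<Pi> \<le> Suc (length \<Gamma>) \<and>
     insert D (set \<Pi>) \<subseteq> \<Union> (subf ` insert C (set \<Gamma>))}"

declare prem_seqs.simps [simp del]

lemma prem_seqs_less: "T \<in> prem_seqs S \<Longrightarrow> (T, S) \<in> seq_less"
  by (cases S) (auto simp: prem_seqs.simps)

lemma prem_seqsI:
  assumes "((\<Pi>, D), (\<Gamma>, C)) \<in> seq_less" "length \<Pi> \<le> Suc (length \<Gamma>)"
    and "\<And>E. E = D \<or> E \<in> set \<Pi> \<Longrightarrow> E = C \<or> E \<in> set \<Gamma> \<or> E \<in> subf C \<or> (\<exists>A\<in>set \<Gamma>. E \<in> subf A)"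
  shows "(\<Pi>, D) \<in> prem_seqs (\<Gamma>, C)"
proof -
  have "E \<in> \<Union> (subf ` insert C (set \<Gamma>))" if "E = D \<or> E \<in> set \<Pi>" for E
    using assms(3)[OF that] self_subf[of E] by blast
  with assms(1,2) show ?thesis
    by (auto simp: prem_seqs.simps)
qed

text \<open>The order alone leaves infinitely many smaller sequents; finiteness comes from bounded
  length over a finite stock of subformulae.\<close>

lemma finite_prem_seqs: "finite (prem_seqs S)"
proof (cases S)
  case (Pair \<Gamma> C)
  let ?U = "\<Union> (subf ` insert C (set \<Gamma>))"
  have sub: "prem_seqs S \<subseteq> {\<Pi>. set \<Pi> \<subseteq> ?U \<and> length \<Pi> \<le> Suc (length \<Gamma>)} \<times> ?U"
    unfolding Pair by (auto simp: prem_seqs.simps)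
  have "finite ?U"
    by simp
  then show ?thesis
    by (intro finite_subset[OF sub] finite_SigmaI finite_lists_length_le)
qed

text \<open>Outside the left rule for the star, premises are smaller, consist of subformulae, and
  are longer by at most one formula (\<open>timesL\<close>, \<open>ldivR\<close>,
  \<open>rdivR\<close>). So only finitely many sequents decide whether such a rule applies. The
  unbounded star premises are left to the hypothesis \<open>star\<close>.\<close>

lemma rule_step_prem_seqs:
  assumes "rule_step X S" and "X \<inter> prem_seqs S \<subseteq> Y"
    and star: "\<And>\<Gamma> A \<Delta> C n. S = (\<Gamma> @ [Star A] @ \<Delta>, C) \<Longrightarrow>
      (\<And>n. (\<Gamma> @ replicate n A @ \<Delta>, C) \<in> X) \<Longrightarrow> (\<Gamma> @ replicate n A @ \<Delta>, C) \<in> Y"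
  shows "rule_step Y S"
proof -
  have sub: "T \<in> Y" if "T \<in> X" "T \<in> prem_seqs S" for T
    using that assms(2) by blast
  show ?thesis
    using assms(1)
  proof cases
    case (ax A) then show ?thesis by (simp add: rule_step.ax)
  next
    case (botL \<Gamma> \<Delta> C) then show ?thesis using rule_step.botL by simp
  next
    case (topR \<Pi>) then show ?thesis by (simp add: rule_step.topR)
  next
    case oneR then show ?thesis by (simp add: rule_step.oneR)
  next
    case (oneL \<Gamma> \<Delta> C)
    have "((\<Gamma> @ \<Delta>, C), S) \<in> seq_less"
      by (rule seq_lessI[where I = "add_mset C (mset (\<Gamma> @ \<Delta>))" and A = One and J = "{#}" and K = "{#}"])
        (use oneL in auto)
    then have "(\<Gamma> @ \<Delta>, C) \<in> Y"
      using oneL by (auto intro!: sub prem_seqsI)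
    then show ?thesis unfolding oneL by (rule rule_step.oneL)
  next
    case (timesL \<Gamma> A B \<Delta> C)
    have "((\<Gamma> @ [A, B] @ \<Delta>, C), S) \<in> seq_less"
      by (rule seq_lessI[where I = "add_mset C (mset (\<Gamma> @ \<Delta>))" and A = "Times A B" and J = "{#}"
            and K = "{#A, B#}"]) (use timesL in auto)
    then have "(\<Gamma> @ [A, B] @ \<Delta>, C) \<in> Y"
      using timesL by (auto intro!: sub prem_seqsI)
    then show ?thesis unfolding timesL by (rule rule_step.timesL)
  next
    case (timesR \<Gamma> A \<Delta> B)
    have "((\<Gamma>, A), S) \<in> seq_less"
      by (rule seq_lessI[where I = "mset \<Gamma>" and A = "Times A B" and J = "mset \<Delta>"
            and K = "{#A#}"]) (use timesR in auto)
    moreover have "((\<Delta>, B), S) \<in> seq_less"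
      by (rule seq_lessI[where I = "mset \<Delta>" and A = "Times A B" and J = "mset \<Gamma>"
            and K = "{#B#}"]) (use timesR in auto)
    ultimately have "(\<Gamma>, A) \<in> Y" "(\<Delta>, B) \<in> Y"
      using timesR by (auto intro!: sub prem_seqsI)
    then show ?thesis unfolding timesR by (rule rule_step.timesR)
  next
    case (ldivL \<Pi> A \<Gamma> B \<Delta> C)
    have "((\<Pi>, A), S) \<in> seq_less"
      by (rule seq_lessI[where I = "mset \<Pi>" and A = "LDiv A B" and J = "add_mset C (mset (\<Gamma> @ \<Delta>))"
            and K = "{#A#}"]) (use ldivL in auto)
    moreover have "((\<Gamma> @ [B] @ \<Delta>, C), S) \<in> seq_less"
      by (rule seq_lessI[where I = "add_mset C (mset (\<Gamma> @ \<Delta>))" and A = "LDiv A B" and J = "mset \<Pi>"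
            and K = "{#B#}"]) (use ldivL in auto)
    ultimately have "(\<Pi>, A) \<in> Y" "(\<Gamma> @ [B] @ \<Delta>, C) \<in> Y"
      using ldivL by (auto intro!: sub prem_seqsI)
    then show ?thesis unfolding ldivL by (rule rule_step.ldivL)
  next
    case (rdivL \<Pi> A \<Gamma> B \<Delta> C)
    have "((\<Pi>, A), S) \<in> seq_less"
      by (rule seq_lessI[where I = "mset \<Pi>" and A = "RDiv B A" and J = "add_mset C (mset (\<Gamma> @ \<Delta>))"
            and K = "{#A#}"]) (use rdivL in auto)
    moreover have "((\<Gamma> @ [B] @ \<Delta>, C), S) \<in> seq_less"
      by (rule seq_lessI[where I = "add_mset C (mset (\<Gamma> @ \<Delta>))" and A = "RDiv B A" and J = "mset \<Pi>"
            and K = "{#B#}"]) (use rdivL in auto)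
    ultimately have "(\<Pi>, A) \<in> Y" "(\<Gamma> @ [B] @ \<Delta>, C) \<in> Y"
      using rdivL by (auto intro!: sub prem_seqsI)
    then show ?thesis unfolding rdivL by (rule rule_step.rdivL)
  next
    case (ldivR A \<Pi> B)
    have "(([A] @ \<Pi>, B), S) \<in> seq_less"
      by (rule seq_lessI[where I = "mset \<Pi>" and A = "LDiv A B" and J = "{#}"
            and K = "{#A, B#}"]) (use ldivR in auto)
    then have "([A] @ \<Pi>, B) \<in> Y"
      using ldivR by (auto intro!: sub prem_seqsI)
    then show ?thesis unfolding ldivR by (rule rule_step.ldivR)
  next
    case (rdivR \<Pi> A B)
    have "((\<Pi> @ [A], B), S) \<in> seq_less"
      by (rule seq_lessI[where I = "mset \<Pi>" and A = "RDiv B A" and J = "{#}"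
            and K = "{#A, B#}"]) (use rdivR in auto)
    then have "(\<Pi> @ [A], B) \<in> Y"
      using rdivR by (auto intro!: sub prem_seqsI)
    then show ?thesis unfolding rdivR by (rule rule_step.rdivR)
  next
    case (meetL1 \<Gamma> A \<Delta> C B)
    have "((\<Gamma> @ [A] @ \<Delta>, C), S) \<in> seq_less"
      by (rule seq_lessI[where I = "add_mset C (mset (\<Gamma> @ \<Delta>))" and A = "Meet A B" and J = "{#}"
            and K = "{#A#}"]) (use meetL1 in auto)
    then have "(\<Gamma> @ [A] @ \<Delta>, C) \<in> Y"
      using meetL1 by (auto intro!: sub prem_seqsI)
    then show ?thesis unfolding meetL1 by (rule rule_step.meetL1)
  next
    case (meetL2 \<Gamma> B \<Delta> C A)
    have "((\<Gamma> @ [B] @ \<Delta>, C), S) \<in> seq_less"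
      by (rule seq_lessI[where I = "add_mset C (mset (\<Gamma> @ \<Delta>))" and A = "Meet A B" and J = "{#}"
            and K = "{#B#}"]) (use meetL2 in auto)
    then have "(\<Gamma> @ [B] @ \<Delta>, C) \<in> Y"
      using meetL2 by (auto intro!: sub prem_seqsI)
    then show ?thesis unfolding meetL2 by (rule rule_step.meetL2)
  next
    case (meetR \<Pi> A B)
    have "((\<Pi>, A), S) \<in> seq_less"
      by (rule seq_lessI[where I = "mset \<Pi>" and A = "Meet A B" and J = "{#}"
            and K = "{#A#}"]) (use meetR in auto)
    moreover have "((\<Pi>, B), S) \<in> seq_less"
      by (rule seq_lessI[where I = "mset \<Pi>" and A = "Meet A B" and J = "{#}"
            and K = "{#B#}"]) (use meetR in auto)
    ultimately have "(\<Pi>, A) \<in> Y" "(\<Pi>, B) \<in> Y"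
      using meetR by (auto intro!: sub prem_seqsI)
    then show ?thesis unfolding meetR by (rule rule_step.meetR)
  next
    case (joinL \<Gamma> A \<Delta> C B)
    have "((\<Gamma> @ [A] @ \<Delta>, C), S) \<in> seq_less"
      by (rule seq_lessI[where I = "add_mset C (mset (\<Gamma> @ \<Delta>))" and A = "Join A B" and J = "{#}"
            and K = "{#A#}"]) (use joinL in auto)
    moreover have "((\<Gamma> @ [B] @ \<Delta>, C), S) \<in> seq_less"
      by (rule seq_lessI[where I = "add_mset C (mset (\<Gamma> @ \<Delta>))" and A = "Join A B" and J = "{#}"
            and K = "{#B#}"]) (use joinL in auto)
    ultimately have "(\<Gamma> @ [A] @ \<Delta>, C) \<in> Y" "(\<Gamma> @ [B] @ \<Delta>, C) \<in> Y"
      using joinL by (auto intro!: sub prem_seqsI)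
    then show ?thesis unfolding joinL by (rule rule_step.joinL)
  next
    case (joinR1 \<Pi> A B)
    have "((\<Pi>, A), S) \<in> seq_less"
      by (rule seq_lessI[where I = "mset \<Pi>" and A = "Join A B" and J = "{#}"
            and K = "{#A#}"]) (use joinR1 in auto)
    then have "(\<Pi>, A) \<in> Y"
      using joinR1 by (auto intro!: sub prem_seqsI)
    then show ?thesis unfolding joinR1 by (rule rule_step.joinR1)
  next
    case (joinR2 \<Pi> B A)
    have "((\<Pi>, B), S) \<in> seq_less"
      by (rule seq_lessI[where I = "mset \<Pi>" and A = "Join A B" and J = "{#}"
            and K = "{#B#}"]) (use joinR2 in auto)
    then have "(\<Pi>, B) \<in> Y"
      using joinR2 by (auto intro!: sub prem_seqsI)
    then show ?thesis unfolding joinR2 by (rule rule_step.joinR2)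
  next
    case (starL \<Gamma> A \<Delta> C)
    then have "(\<Gamma> @ replicate n A @ \<Delta>, C) \<in> Y" for n
      by (intro star)
    then show ?thesis unfolding starL by (rule rule_step.starL)
  next
    case (starR \<Pi>s A)
    have "(\<Pi>, A) \<in> Y" if \<Pi>: "\<Pi> \<in> set \<Pi>s" for \<Pi>
    proof -
      \<comment> \<open>The other blocks of the concatenation are what the premise loses, hence they
        form \<open>J\<close>.\<close>
      obtain \<Pi>s1 \<Pi>s2 where eq: "\<Pi>s = \<Pi>s1 @ \<Pi> # \<Pi>s2"
        using \<Pi> by (meson split_list)
      have "((\<Pi>, A), S) \<in> seq_less"
        by (rule seq_lessI[where I = "mset \<Pi>" and A = "Star A"
              and J = "mset (concat \<Pi>s1 @ concat \<Pi>s2)" and K = "{#A#}"]) (use starR eq in auto)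
      then show ?thesis
        using starR \<Pi> eq by (auto intro!: sub prem_seqsI)
    qed
    then show ?thesis unfolding starR by (rule rule_step.starR)
  qed
qed

section \<open>Existence of finite refutations\<close>

lemma finite_star_splits: "finite {(\<Gamma>, A, \<Delta>). \<Pi> = \<Gamma> @ [Star A] @ \<Delta>}"
proof -
  let ?ls = "{xs. set xs \<subseteq> set \<Pi> \<and> length xs \<le> length \<Pi>}"
  \<comment> \<open>\<open>A\<close> stays in a finite set because it is a subformula of the member
    \<open>Star A\<close> of \<open>\<Pi>\<close>.\<close>
  have sub: "{(\<Gamma>, A, \<Delta>). \<Pi> = \<Gamma> @ [Star A] @ \<Delta>} \<subseteq> ?ls \<times> \<Union> (subf ` set \<Pi>) \<times> ?ls"
    by (auto intro: self_subf)
  show ?thesis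
    by (intro finite_subset[OF sub] finite_SigmaI finite_lists_length_le) auto
qed

lemma finite_refutation:
  assumes "\<not> \<Gamma> \<turnstile> C"
  shows "\<exists>F. finite F \<and> refutation F \<and> (\<Gamma>, C) \<in> F"
proof -
  define D where "D = {(\<Gamma>, C). \<Gamma> \<turnstile> C}"
  have "S \<notin> D \<Longrightarrow> \<exists>F. finite F \<and> refutation F \<and> S \<in> F" for S
    using wf_seq_less
  proof (induction S rule: wf_induct_rule)
    case (less S)
    have "\<exists>R. \<forall>T. (T, S) \<in> seq_less \<longrightarrow> T \<notin> D \<longrightarrow> finite (R T) \<and> refutation (R T) \<and> T \<in> R T"
      using less.IH by metis
    then obtain R where R: "\<And>T. (T, S) \<in> seq_less \<Longrightarrow> T \<notin> D \<Longrightarrow>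
        finite (R T) \<and> refutation (R T) \<and> T \<in> R T"
      by metis
    obtain \<Pi> C where S: "S = (\<Pi>, C)"
      by (cases S)
    define st :: "form list \<times> form \<times> form list \<Rightarrow> nat \<Rightarrow> seq"
      where "st = (\<lambda>(\<Gamma>, A, \<Delta>) n. (\<Gamma> @ replicate n A @ \<Delta>, C))"
    \<comment> \<open>\<open>bad t\<close> selects an underivable premise of the star instance
      \<open>t\<close>. If all its premises are derivable, the choice is arbitrary and the selected
      one is discarded by \<open>- D\<close> in \<open>W\<close>.\<close>
    define bad where "bad = (\<lambda>t. SOME n. st t n \<notin> D)"
    define St where "St = (\<lambda>t. st t (bad t)) ` {(\<Gamma>, A, \<Delta>). \<Pi> = \<Gamma> @ [Star A] @ \<Delta>}"
    define W where "W = (prem_seqs S \<union> St) - D"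
    have "finite W"
      unfolding W_def St_def by (intro finite_Diff finite_UnI finite_imageI finite_prem_seqs finite_star_splits)
    have less_st: "(st (\<Gamma>, A, \<Delta>) n, S) \<in> seq_less" if "\<Pi> = \<Gamma> @ [Star A] @ \<Delta>" for \<Gamma> A \<Delta> n
      by (rule seq_lessI[where I = "add_mset C (mset (\<Gamma> @ \<Delta>))" and A = "Star A" and J = "{#}"
            and K = "mset (replicate n A)"]) (use that S in \<open>auto simp: st_def split: if_splits\<close>)
    have W: "finite (R T) \<and> refutation (R T) \<and> T \<in> R T" if "T \<in> W" for T
    proof (rule R)
      have "T \<in> prem_seqs S \<or> (\<exists>\<Gamma> A \<Delta> n. T = st (\<Gamma>, A, \<Delta>) n \<and> \<Pi> = \<Gamma> @ [Star A] @ \<Delta>)"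
        using that unfolding W_def St_def by blast
      then show "(T, S) \<in> seq_less"
        using less_st prem_seqs_less by blast
      show "T \<notin> D"
        using that unfolding W_def by blast
    qed
    define F where "F = insert S (\<Union> (R ` W))"
    have "W \<subseteq> F"
      using W by (auto simp: F_def)
    \<comment> \<open>All underivable sequents among the relevant premises lie in \<open>W\<close>
      and hence in \<open>F\<close>, so an instance with premises outside \<open>F\<close> would
      derive \<open>S\<close>.\<close>
    have "\<not> rule_step (- F) S"
    proof
      assume "rule_step (- F) S"
      then have "rule_step D S"
      proof (rule rule_step_prem_seqs)
        show "- F \<inter> prem_seqs S \<subseteq> D"
          using \<open>W \<subseteq> F\<close> by (auto simp: W_def)
      next
        fix \<Gamma> A \<Delta> C' n
        assume *: "S = (\<Gamma> @ [Star A] @ \<Delta>, C')" "\<And>n. (\<Gamma> @ replicate n A @ \<Delta>, C') \<in> - F"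
        let ?t = "(\<Gamma>, A, \<Delta>)"
        have "C' = C" and split: "\<Pi> = \<Gamma> @ [Star A] @ \<Delta>"
          using * S by auto
        have "st ?t (bad ?t) \<in> - F"
          using *(2) \<open>C' = C\<close> by (simp add: st_def)
        then have "st ?t (bad ?t) \<notin> W"
          using \<open>W \<subseteq> F\<close> by blast
        moreover have "st ?t (bad ?t) \<in> St"
          unfolding St_def using split by (intro imageI) simp
        ultimately have "st ?t (bad ?t) \<in> D"
          unfolding W_def by blast
        \<comment> \<open>If the premise selected by \<open>bad\<close> is derivable, then no
          premise of this instance is underivable.\<close>
        then have "st ?t n \<in> D"
          unfolding bad_def by (rule contrapos_pp) (rule someI)
        then show "(\<Gamma> @ replicate n A @ \<Delta>, C') \<in> D"
          using \<open>C' = C\<close> by (simp add: st_def)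
      qed
      then show False
        using less.prems rule_step_sound S by (auto simp: D_def)
    qed
    \<comment> \<open>Refutations survive enlargement by union: the complement shrinks and
      \<open>rule_step\<close> is monotone.\<close>
    moreover have "\<not> rule_step (- F) T" if "T \<in> R U" "U \<in> W" for T U
    proof
      assume "rule_step (- F) T"
      then have "rule_step (- R U) T"
        by (rule rule_step_mono) (use that F_def in auto)
      then show False
        using W that unfolding refutation_def by blast
    qed
    ultimately have "refutation F"
      unfolding refutation_def by (auto simp: F_def)
    moreover have "finite F"
      using W \<open>finite W\<close> by (auto simp: F_def)
    ultimately show ?case
      by (auto simp: F_def)
  qed
  then show ?thesis
    using assms by (simp add: D_def)
qed

section \<open>Syntactic concepts\<close>

lemma concI: "u \<in> M \<Longrightarrow> v \<in> N \<Longrightarrow> u @ v \<in> conc M N"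
  by (auto simp: conc_def)

lemma cl_subset_lists: "cl \<Sigma> L M \<subseteq> lists \<Sigma>"
  by (auto simp: cl_def fillers_def)

lemma cl_mono: "M \<subseteq> N \<Longrightarrow> cl \<Sigma> L M \<subseteq> cl \<Sigma> L N"
  unfolding cl_def fillers_def ctxs_def by blast

lemma subset_cl: "M \<subseteq> lists \<Sigma> \<Longrightarrow> M \<subseteq> cl \<Sigma> L M"
  by (auto simp: cl_def fillers_def ctxs_def)

text \<open>\<open>ctxs\<close> and \<open>fillers\<close> form a Galois connection, so all sets of
  fillers are closed.\<close>

lemma fillers_closed: "fillers \<Sigma> L C \<in> concepts \<Sigma> L" if "C \<subseteq> lists \<Sigma> \<times> lists \<Sigma>"
  using that unfolding concepts_def cl_def fillers_def ctxs_def by blast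

lemma cl_closed: "cl \<Sigma> L M \<in> concepts \<Sigma> L"
  unfolding cl_def by (rule fillers_closed) (auto simp: ctxs_def)

lemma concepts_subset_lists: "M \<in> concepts \<Sigma> L \<Longrightarrow> M \<subseteq> lists \<Sigma>"
  by (simp add: concepts_def)

lemma cl_concept: "M \<in> concepts \<Sigma> L \<Longrightarrow> cl \<Sigma> L M = M"
  by (simp add: concepts_def)

lemma cl_least: "M \<subseteq> N \<Longrightarrow> N \<in> concepts \<Sigma> L \<Longrightarrow> cl \<Sigma> L M \<subseteq> N"
  by (metis cl_mono cl_concept)

lemma concept_memI:
  assumes "M \<in> concepts \<Sigma> L" "v \<in> lists \<Sigma>"
    and "\<And>x y. x \<in> lists \<Sigma> \<Longrightarrow> y \<in> lists \<Sigma> \<Longrightarrow> (\<And>w. w \<in> M \<Longrightarrow> x @ w @ y \<in> L) \<Longrightarrow> x @ v @ y \<in> L"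
  shows "v \<in> M"
proof -
  have "v \<in> cl \<Sigma> L M"
    using assms(2,3) by (auto simp: cl_def fillers_def ctxs_def)
  then show ?thesis
    by (simp add: cl_concept[OF assms(1)])
qed

section \<open>Closure of concepts under the operations\<close>

lemma lists_concept: "lists \<Sigma> \<in> concepts \<Sigma> L"
  using subset_cl[of "lists \<Sigma>" \<Sigma> L] cl_subset_lists[of \<Sigma> L "lists \<Sigma>"] by (auto simp: concepts_def)

lemma Int_concept:
  assumes M: "M \<in> concepts \<Sigma> L" and N: "N \<in> concepts \<Sigma> L"
  shows "M \<inter> N \<in> concepts \<Sigma> L"
proof -
  have "M \<inter> N \<subseteq> lists \<Sigma>"
    using concepts_subset_lists[OF M] by blast
  moreover have "cl \<Sigma> L (M \<inter> N) \<subseteq> M \<inter> N"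
    using cl_least[OF Int_lower1 M] cl_least[OF Int_lower2 N] by blast
  ultimately show ?thesis
    using subset_cl unfolding concepts_def by blast
qed

text \<open>A context \<open>(x, y)\<close> of \<open>N\<close> and a word \<open>v\<close> of
  \<open>M\<close> give the context \<open>(x @ v, y)\<close> of the quotient. For
  \<open>rquot\<close> the word moves to the right component instead.\<close>

lemma lquot_concept:
  assumes M: "M \<subseteq> lists \<Sigma>" and N: "N \<in> concepts \<Sigma> L"
  shows "lquot \<Sigma> M N \<in> concepts \<Sigma> L"
proof -
  have "u \<in> lquot \<Sigma> M N" if u: "u \<in> cl \<Sigma> L (lquot \<Sigma> M N)" for u
  proof -
    have "v @ u \<in> N" if "v \<in> M" for v
    proof (rule concept_memI[OF N])
      show "v @ u \<in> lists \<Sigma>"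
        using u that M cl_subset_lists[of \<Sigma> L] by auto
    next
      fix x y assume xy: "x \<in> lists \<Sigma>" "y \<in> lists \<Sigma>" "\<And>w. w \<in> N \<Longrightarrow> x @ w @ y \<in> L"
      have "(x @ v, y) \<in> ctxs \<Sigma> L (lquot \<Sigma> M N)"
        using xy that M xy(3)[of "v @ _"] by (auto simp: ctxs_def lquot_def)
      then show "x @ (v @ u) @ y \<in> L"
        using u by (auto simp: cl_def fillers_def)
    qed
    then show ?thesis
      using u cl_subset_lists[of \<Sigma> L] by (auto simp: lquot_def)
  qed
  moreover have "lquot \<Sigma> M N \<subseteq> lists \<Sigma>"
    by (auto simp: lquot_def)
  ultimately show ?thesis
    using subset_cl[of "lquot \<Sigma> M N" \<Sigma> L] by (auto simp: concepts_def)
qed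

lemma rquot_concept:
  assumes M: "M \<subseteq> lists \<Sigma>" and N: "N \<in> concepts \<Sigma> L"
  shows "rquot \<Sigma> N M \<in> concepts \<Sigma> L"
proof -
  have "u \<in> rquot \<Sigma> N M" if u: "u \<in> cl \<Sigma> L (rquot \<Sigma> N M)" for u
  proof -
    have "u @ v \<in> N" if "v \<in> M" for v
    proof (rule concept_memI[OF N])
      show "u @ v \<in> lists \<Sigma>"
        using u that M cl_subset_lists[of \<Sigma> L] by auto
    next
      fix x y assume xy: "x \<in> lists \<Sigma>" "y \<in> lists \<Sigma>" "\<And>w. w \<in> N \<Longrightarrow> x @ w @ y \<in> L"
      have "(x, v @ y) \<in> ctxs \<Sigma> L (rquot \<Sigma> N M)"
        using xy that M xy(3)[of "_ @ v"] by (auto simp: ctxs_def rquot_def)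
      then show "x @ (u @ v) @ y \<in> L"
        using u by (auto simp: cl_def fillers_def)
    qed
    then show ?thesis
      using u cl_subset_lists[of \<Sigma> L] by (auto simp: rquot_def)
  qed
  moreover have "rquot \<Sigma> N M \<subseteq> lists \<Sigma>"
    by (auto simp: rquot_def)
  ultimately show ?thesis
    using subset_cl[of "rquot \<Sigma> N M" \<Sigma> L] by (auto simp: concepts_def)
qed

section \<open>The model of a refutation\<close>

instance form :: countable
  by countable_datatype

text \<open>The sum type keeps antecedent and succedent letters apart. Numbers that encode nothing
  may remain; since \<open>lang\<close> excludes only antecedent words and words of
  \<open>F\<close>, they make a word belong to \<open>lang\<close>.\<close>

definition ante :: "form \<Rightarrow> nat" where
  "ante A = to_nat (Inl A :: form + form)"

definition succ :: "form \<Rightarrow> nat" where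
  "succ A = to_nat (Inr A :: form + form)"

lemma ante_eq_iff [simp]: "ante A = ante B \<longleftrightarrow> A = B"
  and succ_eq_iff [simp]: "succ A = succ B \<longleftrightarrow> A = B"
  and ante_neq_succ [simp]: "ante A \<noteq> succ B" "succ B \<noteq> ante A"
  by (simp_all add: ante_def succ_def)

lemma map_ante_eq_iff [simp]: "map ante \<Gamma> = map ante \<Delta> \<longleftrightarrow> \<Gamma> = \<Delta>"
  by (rule inj_map_eq_map) (simp add: inj_def)

fun seq_word :: "seq \<Rightarrow> nat list" where
  "seq_word (\<Gamma>, C) = map ante \<Gamma> @ [succ C]"

definition lang :: "seq set \<Rightarrow> nat list set" where
  "lang F = - (range (map ante) \<union> seq_word ` F)"

text \<open>The contexts of all sets that contain a word of antecedent letters are of this kind; hence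
  their fillers, which form the local zero, belong to all such concepts.\<close>

definition seq_ctxs :: "(nat list \<times> nat list) set" where
  "seq_ctxs = {(x, y). x @ y \<notin> range (map ante)}"

lemma append_range_map_iff:
  "x @ y \<in> range (map f) \<longleftrightarrow> x \<in> range (map f) \<and> y \<in> range (map f)"
  by (auto simp: image_iff append_eq_map_conv)

lemma seq_ctxsI: "x @ map ante \<Gamma> @ y \<in> lang F \<Longrightarrow> (x, y) \<in> seq_ctxs"
  by (auto simp: seq_ctxs_def lang_def append_range_map_iff)

text \<open>The context contains a letter that is not an antecedent letter, so the word can be
  missing from \<open>lang F\<close> only by encoding a sequent of \<open>F\<close>. That sequent
  then splits around the inserted \<open>A\<close>.\<close>

lemma ante_lang:
  assumes "(x, y) \<in> seq_ctxs"
    and *: "\<And>\<Gamma> \<Delta> C. x = map ante \<Gamma> \<Longrightarrow> y = map ante \<Delta> @ [succ C] \<Longrightarrow> (\<Gamma> @ [A] @ \<Delta>, C) \<notin> F"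
  shows "x @ [ante A] @ y \<in> lang F"
proof (rule ccontr)
  assume "x @ [ante A] @ y \<notin> lang F"
  moreover have "x @ [ante A] @ y \<notin> range (map ante)"
    using assms(1) unfolding seq_ctxs_def append_range_map_iff by blast
  ultimately obtain \<Pi> C where seq: "(\<Pi>, C) \<in> F" "x @ [ante A] @ y = map ante \<Pi> @ [succ C]"
    by (auto simp: lang_def)
  \<comment> \<open>The last letter of the word is a succedent letter, so it is not
    \<open>ante A\<close> and must end \<open>y\<close>.\<close>
  obtain y' where y: "y = y' @ [succ C]"
    using seq(2) by (cases y rule: rev_cases) auto
  then have "map ante \<Pi> = x @ ante A # y'"
    using seq(2) by simp
  then obtain \<Gamma> \<Delta> where "\<Pi> = \<Gamma> @ [A] @ \<Delta>" "x = map ante \<Gamma>" "y' = map ante \<Delta>"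
    by (auto simp: map_eq_append_conv map_eq_Cons_conv)
  with * seq(1) y show False
    by blast
qed

lemma seq_word_not_ante: "u @ [succ A] \<notin> range (map ante)"
  by (auto simp: append_eq_map_conv)

lemma succ_lang: "u @ [succ A] \<in> lang F" if "\<And>\<Gamma>. u = map ante \<Gamma> \<Longrightarrow> (\<Gamma>, A) \<notin> F"
  using that seq_word_not_ante[of u A] by (auto simp: lang_def)

lemma seq_word_lang [simp]: "map ante \<Gamma> @ [succ C] \<in> lang F \<longleftrightarrow> (\<Gamma>, C) \<notin> F"
  using seq_word_not_ante[of "map ante \<Gamma>" C] by (force simp: lang_def)

section \<open>The local zero and the finiteness of its cone\<close>

definition zero :: "seq set \<Rightarrow> nat list set" where
  "zero F = fillers UNIV (lang F) seq_ctxs"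

lemma zero_concept: "zero F \<in> concepts UNIV (lang F)"
  by (simp add: zero_def fillers_closed)

lemma zero_subset_cl: "map ante \<Gamma> \<in> M \<Longrightarrow> zero F \<subseteq> cl UNIV (lang F) M"
  using seq_ctxsI by (fastforce simp: zero_def cl_def fillers_def ctxs_def)

lemma zero_subset: "M \<in> concepts UNIV (lang F) \<Longrightarrow> map ante \<Gamma> \<in> M \<Longrightarrow> zero F \<subseteq> M"
  using zero_subset_cl[of \<Gamma> M F] by (simp add: cl_concept)

text \<open>Shifting \<open>u\<close> and \<open>w\<close> into the context only adds letters, so a
  letter outside the antecedent alphabet remains. This yields the absorption required of a local
  zero.\<close>

lemma zero_ideal:
  assumes "v \<in> zero F"
  shows "u @ v @ w \<in> zero F"
proof -
  have "(x @ u, w @ y) \<in> seq_ctxs" if "(x, y) \<in> seq_ctxs" for x y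
    using that unfolding seq_ctxs_def by (auto simp: append_range_map_iff)
  then show ?thesis
    using assms by (fastforce simp: zero_def fillers_def)
qed

text \<open>A word missing from \<open>M\<close> is separated from the member
  \<open>map ante \<Gamma>\<close> by some context. That context has a letter that is not an
  antecedent letter, so the missing word is a factor of a word encoding a sequent of
  \<open>F\<close>.\<close>

lemma finite_cone:
  assumes "finite F" "map ante \<Gamma> \<in> zero F"
  shows "finite (cone UNIV (lang F) (zero F))"
proof -
  \<comment> \<open>A finite superset of the factors of these words, bounded by letters and
    length.\<close>
  let ?U = "\<Union>w \<in> seq_word ` F. {v. set v \<subseteq> set w \<and> length v \<le> length w}"
  have "M \<in> uminus ` Pow ?U" if M: "M \<in> cone UNIV (lang F) (zero F)" for M
  proof
    have "v \<in> ?U" if v: "v \<notin> M" for v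
    proof -
      have "M \<in> concepts UNIV (lang F)" "map ante \<Gamma> \<in> M"
        using M assms by (auto simp: cone_def)
      then obtain x y where *: "x @ map ante \<Gamma> @ y \<in> lang F" "x @ v @ y \<notin> lang F"
        using v concept_memI[of M UNIV "lang F" v] by auto
      have "x @ v @ y \<notin> range (map ante)"
        using seq_ctxsI[OF *(1)] by (auto simp: seq_ctxs_def append_range_map_iff)
      with * show ?thesis
        by (intro UN_I[of "x @ v @ y"]) (auto simp: lang_def)
    qed
    then show "- M \<in> Pow ?U"
      by blast
    show "M = - (- M)"
      by simp
  qed
  then have "cone UNIV (lang F) (zero F) \<subseteq> uminus ` Pow ?U"
    by blast
  moreover have "finite ?U"
    using assms by (simp add: finite_lists_length_le)
  ultimately show ?thesis
    by (meson finite_Pow_iff finite_imageI finite_subset)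
qed

text \<open>This is the outer value of a formula in the style of Okada's semantic cut elimination,
  with non-membership in \<open>F\<close> in place of cut-free provability.\<close>

definition deriving :: "seq set \<Rightarrow> form \<Rightarrow> nat list set" where
  "deriving F A = {u. u @ [succ A] \<in> lang F}"

lemma deriving_concept: "deriving F A \<in> concepts UNIV (lang F)"
proof -
  have "deriving F A = fillers UNIV (lang F) {([], [succ A])}"
    by (simp add: deriving_def fillers_def)
  then show ?thesis
    by (simp add: fillers_closed)
qed

lemma map_ante_deriving [simp]: "map ante \<Gamma> \<in> deriving F A \<longleftrightarrow> (\<Gamma>, A) \<notin> F"
  by (simp add: deriving_def)

abbreviation value_of :: "seq set \<Rightarrow> form \<Rightarrow> nat list set" where
  "value_of F \<equiv> interp UNIV (lang F) (zero F) (\<lambda>p. deriving F (Var p))"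

lemma value_concept: "value_of F A \<in> concepts UNIV (lang F)"
  by (induction A)
    (simp_all add: deriving_concept cl_closed unit_def fuse_def Int_concept lquot_concept
      rquot_concept zero_concept lists_concept[of UNIV, simplified])

text \<open>The common form of left rules: \<open>*\<close> says that a left rule for
  \<open>A\<close> takes its premises from antecedent words of \<open>M\<close>. The word of
  \<open>\<Theta>\<close> ensures that all contexts of \<open>M\<close> lie in
  \<open>seq_ctxs\<close>.\<close>

lemma ante_cl:
  assumes "map ante \<Theta> \<in> M"
    and *: "\<And>\<Gamma> \<Delta> C. (\<And>\<Pi>. map ante \<Pi> \<in> M \<Longrightarrow> (\<Gamma> @ \<Pi> @ \<Delta>, C) \<in> - F) \<Longrightarrow> (\<Gamma> @ [A] @ \<Delta>, C) \<notin> F"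
  shows "[ante A] \<in> cl UNIV (lang F) M"
proof -
  have "x @ [ante A] @ y \<in> lang F" if xy: "\<And>w. w \<in> M \<Longrightarrow> x @ w @ y \<in> lang F" for x y
  proof (rule ante_lang)
    show "(x, y) \<in> seq_ctxs"
      using seq_ctxsI xy assms(1) by blast
    fix \<Gamma> \<Delta> C assume "x = map ante \<Gamma>" "y = map ante \<Delta> @ [succ C]"
    then have "(\<Gamma> @ \<Pi> @ \<Delta>, C) \<in> - F" if "map ante \<Pi> \<in> M" for \<Pi>
      using xy[OF that] seq_word_lang[of "\<Gamma> @ \<Pi> @ \<Delta>" C F] by simp
    then show "(\<Gamma> @ [A] @ \<Delta>, C) \<notin> F"
      by (rule *)
  qed
  then show ?thesis
    by (auto simp: cl_def fillers_def ctxs_def)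
qed

text \<open>Other words followed by \<open>succ A\<close> encode no sequent and contain a succedent
  letter, so they are in \<open>lang F\<close> anyway.\<close>

lemma subset_derivingI:
  "M \<subseteq> deriving F A" if "\<And>\<Gamma>. map ante \<Gamma> \<in> M \<Longrightarrow> (\<Gamma>, A) \<notin> F"
  using that by (auto simp: deriving_def intro!: succ_lang)

section \<open>Bounds on the values of formulae under the refutation property\<close>

context
  fixes F :: "seq set"
  assumes F: "refutation F"
begin

lemma refuted: "rule_step (- F) S \<Longrightarrow> S \<notin> F"
  using F by (auto simp: refutation_def)

text \<open>The rule \<open>botL\<close> has no premises, so no sequent of \<open>F\<close> has
  \<open>Bot\<close> in its antecedent.\<close>

lemma Bot_in_zero: "[ante Bot] \<in> zero F"
  by (auto simp: zero_def fillers_def intro!: ante_lang[simplified] refuted rule_step.botL[simplified])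

text \<open>Whenever the context completes the word to a sequent, \<open>v\<close> encodes a list
  \<open>\<Pi>\<close> for which \<open>\<Pi>\<close> to \<open>A\<close> lies outside
  \<open>F\<close>. The other premise of \<open>ldivL\<close> is outside \<open>F\<close> because
  \<open>[ante B]\<close> is in \<open>M\<close>.\<close>

lemma ldiv_value:
  assumes v: "v \<in> deriving F A" and B: "[ante B] \<in> M" and M: "M \<in> concepts UNIV (lang F)"
  shows "v @ [ante (LDiv A B)] \<in> M"
proof (rule concept_memI[OF M])
  fix x y assume xy: "\<And>w. w \<in> M \<Longrightarrow> x @ w @ y \<in> lang F"
  have "(x @ v) @ [ante (LDiv A B)] @ y \<in> lang F"
  proof (rule ante_lang)
    show "(x @ v, y) \<in> seq_ctxs"
      using seq_ctxsI[of x "[B]" y F] xy[OF B] by (auto simp: seq_ctxs_def append_range_map_iff)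
    fix \<Gamma> \<Delta> C assume x: "x @ v = map ante \<Gamma>" and y: "y = map ante \<Delta> @ [succ C]"
    obtain \<Gamma>' \<Pi> where \<Gamma>: "\<Gamma> = \<Gamma>' @ \<Pi>" "x = map ante \<Gamma>'" "v = map ante \<Pi>"
      using x by (auto simp: append_eq_map_conv)
    have "(\<Pi>, A) \<in> - F"
      using v \<Gamma> by simp
    moreover have "(\<Gamma>' @ [B] @ \<Delta>, C) \<in> - F"
      using xy[OF B] \<Gamma> y seq_word_lang[of "\<Gamma>' @ [B] @ \<Delta>" C F] by simp
    ultimately show "(\<Gamma> @ [LDiv A B] @ \<Delta>, C) \<notin> F"
      using refuted[OF rule_step.ldivL] \<Gamma> by simp
  qed
  then show "x @ (v @ [ante (LDiv A B)]) @ y \<in> lang F" by simp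
qed simp

lemma rdiv_value:
  assumes v: "v \<in> deriving F A" and B: "[ante B] \<in> M" and M: "M \<in> concepts UNIV (lang F)"
  shows "[ante (RDiv B A)] @ v \<in> M"
proof (rule concept_memI[OF M])
  fix x y assume xy: "\<And>w. w \<in> M \<Longrightarrow> x @ w @ y \<in> lang F"
  have ctx: "(x, y) \<in> seq_ctxs"
    using seq_ctxsI[of x "[B]" y F] xy[OF B] by simp
  have "x @ [ante (RDiv B A)] @ v @ y \<in> lang F"
  proof (rule ante_lang)
    show "(x, v @ y) \<in> seq_ctxs"
      using ctx by (auto simp: seq_ctxs_def append_range_map_iff)
    fix \<Gamma> \<Delta> C assume x: "x = map ante \<Gamma>" and vy: "v @ y = map ante \<Delta> @ [succ C]"
    \<comment> \<open>This excludes that the succedent letter is the end of \<open>v\<close>: with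
      \<open>y\<close> empty, the context would consist of antecedent letters only.\<close>
    have "y \<noteq> []"
      using ctx x by (auto simp: seq_ctxs_def)
    then obtain y' where y: "y = y' @ [succ C]"
      using vy by (cases y rule: rev_cases) auto
    then obtain \<Pi> \<Delta>' where \<Delta>: "\<Delta> = \<Pi> @ \<Delta>'" "v = map ante \<Pi>" "y' = map ante \<Delta>'"
      using vy by (auto simp: append_eq_map_conv)
    have "(\<Pi>, A) \<in> - F"
      using v \<Delta> by simp
    moreover have "(\<Gamma> @ [B] @ \<Delta>', C) \<in> - F"
      using xy[OF B] \<Delta> x y seq_word_lang[of "\<Gamma> @ [B] @ \<Delta>'" C F] by simp
    ultimately show "(\<Gamma> @ [RDiv B A] @ \<Delta>, C) \<notin> F"
      using refuted[OF rule_step.rdivL] \<Delta> by simp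
  qed
  then show "x @ ([ante (RDiv B A)] @ v) @ y \<in> lang F" by simp
qed simp

lemma conc_deriving: "conc (deriving F A) (deriving F B) \<subseteq> deriving F (Times A B)"
proof (rule subset_derivingI, rule refuted)
  fix \<Gamma> assume "map ante \<Gamma> \<in> conc (deriving F A) (deriving F B)"
  then obtain \<Pi> \<Delta> where "\<Gamma> = \<Pi> @ \<Delta>" "map ante \<Pi> \<in> deriving F A" "map ante \<Delta> \<in> deriving F B"
    by (auto simp: conc_def map_eq_append_conv)
  then show "rule_step (- F) (\<Gamma>, Times A B)"
    by (auto intro: rule_step.timesR)
qed

lemma map_ante_eq_concat:
  "map ante \<Gamma> = concat ws \<Longrightarrow> \<exists>\<Pi>s. \<Gamma> = concat \<Pi>s \<and> ws = map (map ante) \<Pi>s"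
proof (induction ws arbitrary: \<Gamma>)
  case Nil
  then show ?case by simp
next
  case (Cons w ws)
  then obtain \<Pi> \<Delta> where \<Gamma>: "\<Gamma> = \<Pi> @ \<Delta>" "w = map ante \<Pi>" "map ante \<Delta> = concat ws"
    by (auto simp: map_eq_append_conv)
  then obtain \<Pi>s where "\<Delta> = concat \<Pi>s" "ws = map (map ante) \<Pi>s"
    using Cons.IH by blast
  with \<Gamma> show ?case
    by (intro exI[of _ "\<Pi> # \<Pi>s"]) simp
qed

lemma kstar_deriving: "kstar (deriving F A) \<subseteq> deriving F (Star A)"
proof (rule subset_derivingI, rule refuted)
  fix \<Gamma> assume "map ante \<Gamma> \<in> kstar (deriving F A)"
  then obtain ws where "map ante \<Gamma> = concat ws" "set ws \<subseteq> deriving F A"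
    by (auto simp: kstar_def)
  moreover then obtain \<Pi>s where "\<Gamma> = concat \<Pi>s" "ws = map (map ante) \<Pi>s"
    using map_ante_eq_concat by blast
  ultimately show "rule_step (- F) (\<Gamma>, Star A)"
    by (auto intro!: rule_step.starR)
qed

text \<open>Left rules give the first bound, right rules the second. The induction must be
  simultaneous: for \<open>LDiv A B\<close>, the first bound uses the second for \<open>A\<close>
  and the first for \<open>B\<close>, while the second uses the first for \<open>A\<close> and the
  second for \<open>B\<close>.\<close>

lemma value_bounds: "[ante A] \<in> value_of F A" "value_of F A \<subseteq> deriving F A"
proof (induction A)
  case (Var p)
  case 1 show ?case
    using refuted[OF rule_step.ax[of _ "Var p"]] map_ante_deriving[of "[Var p]" F "Var p"] by simp
  case 2 show ?case by simp
next
  case Top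
  case 1 show ?case by simp
  case 2 show ?case
    by (intro subset_derivingI refuted rule_step.topR)
next
  case Bot
  case 1 show ?case
    by (simp add: Bot_in_zero)
  case 2
  \<comment> \<open>Hence \<open>deriving F Bot\<close> contains an antecedent word, and every such
    concept includes the zero.\<close>
  have "([Bot], Bot) \<notin> F"
    using refuted rule_step.ax by blast
  then show ?case
    using zero_subset[OF deriving_concept, of "[Bot]"] map_ante_deriving[of "[Bot]"] by simp
next
  case One
  case 1 show ?case
    unfolding interp.simps unit_def
  proof (rule ante_cl[where \<Theta> = "[]"], simp, rule refuted, rule rule_step.oneL)
    fix \<Gamma> \<Delta> C
    assume "\<And>\<Pi>. map ante \<Pi> \<in> {[]} \<Longrightarrow> (\<Gamma> @ \<Pi> @ \<Delta>, C) \<in> - F"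
    from this[of "[]"] show "(\<Gamma> @ \<Delta>, C) \<in> - F"
      by simp
  qed
  case 2 show ?case
    unfolding interp.simps unit_def
    by (intro cl_least deriving_concept subset_derivingI refuted) (simp add: rule_step.oneR)
next
  case (LDiv A B)
  case 1 show ?case
    using LDiv ldiv_value[OF _ _ value_concept] by (auto simp: lquot_def)
  case 2 show ?case
  proof (rule subset_derivingI, rule refuted, rule rule_step.ldivR)
    fix \<Gamma> assume "map ante \<Gamma> \<in> value_of F (LDiv A B)"
    then have "map ante ([A] @ \<Gamma>) \<in> deriving F B"
      using LDiv by (auto simp: lquot_def)
    then show "([A] @ \<Gamma>, B) \<in> - F"
      unfolding map_ante_deriving by simp
  qed
next
  case (RDiv B A)
  case 1 show ?case
    using RDiv rdiv_value[OF _ _ value_concept] by (auto simp: rquot_def)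
  case 2 show ?case
  proof (rule subset_derivingI, rule refuted, rule rule_step.rdivR)
    fix \<Gamma> assume "map ante \<Gamma> \<in> value_of F (RDiv B A)"
    then have "map ante (\<Gamma> @ [A]) \<in> deriving F B"
      using RDiv by (auto simp: rquot_def)
    then show "(\<Gamma> @ [A], B) \<in> - F"
      unfolding map_ante_deriving by simp
  qed
next
  case (Times A B)
  have AB: "map ante [A, B] \<in> conc (value_of F A) (value_of F B)"
    using concI[OF Times(1,3)] by simp
  case 1 show ?case
    unfolding interp.simps fuse_def
    by (rule ante_cl[OF AB], rule refuted, rule rule_step.timesL) (use AB in blast)
  case 2
  have "conc (value_of F A) (value_of F B) \<subseteq> conc (deriving F A) (deriving F B)"
    using Times by (auto simp: conc_def)
  then show ?case
    unfolding interp.simps fuse_def using conc_deriving by (intro cl_least deriving_concept) blast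
next
  case (Meet A B)
  \<comment> \<open>The value of each conjunct is its own closure, so \<open>ante_cl\<close> applies
    to it with the matching left rule.\<close>
  have "[ante (Meet A B)] \<in> cl UNIV (lang F) (value_of F A)"
  proof (rule ante_cl[of "[A]"], use Meet in simp, rule refuted, rule rule_step.meetL1)
    fix \<Gamma> \<Delta> C
    assume "\<And>\<Pi>. map ante \<Pi> \<in> value_of F A \<Longrightarrow> (\<Gamma> @ \<Pi> @ \<Delta>, C) \<in> - F"
    from this[of "[A]"] show "(\<Gamma> @ [A] @ \<Delta>, C) \<in> - F"
      using Meet by simp
  qed
  moreover have "[ante (Meet A B)] \<in> cl UNIV (lang F) (value_of F B)"
  proof (rule ante_cl[of "[B]"], use Meet in simp, rule refuted, rule rule_step.meetL2)
    fix \<Gamma> \<Delta> C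
    assume "\<And>\<Pi>. map ante \<Pi> \<in> value_of F B \<Longrightarrow> (\<Gamma> @ \<Pi> @ \<Delta>, C) \<in> - F"
    from this[of "[B]"] show "(\<Gamma> @ [B] @ \<Delta>, C) \<in> - F"
      using Meet by simp
  qed
  moreover case 1
  ultimately show ?case
    by (simp add: cl_concept[OF value_concept])
  case 2 show ?case
  proof (rule subset_derivingI, rule refuted)
    fix \<Gamma> assume "map ante \<Gamma> \<in> value_of F (Meet A B)"
    then have "map ante \<Gamma> \<in> deriving F A" "map ante \<Gamma> \<in> deriving F B"
      using Meet by auto
    then show "rule_step (- F) (\<Gamma>, Meet A B)"
      by (simp add: rule_step.meetR)
  qed
next
  case (Join A B)
  let ?M = "value_of F A \<union> value_of F B"
  have AB: "map ante [A] \<in> ?M" "map ante [B] \<in> ?M"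
    using Join by simp_all
  case 1 show ?case
    unfolding interp.simps
    by (rule ante_cl[OF AB(1)], rule refuted, rule rule_step.joinL) (use AB in blast)+
  case 2 show ?case
    unfolding interp.simps
  proof (intro cl_least deriving_concept subset_derivingI refuted)
    fix \<Gamma> assume "map ante \<Gamma> \<in> ?M"
    then have "map ante \<Gamma> \<in> deriving F A \<or> map ante \<Gamma> \<in> deriving F B"
      using Join by blast
    then show "rule_step (- F) (\<Gamma>, Join A B)"
      by (auto intro: rule_step.joinR1 rule_step.joinR2)
  qed
next
  case (Star A)
  \<comment> \<open>These powers supply the infinitely many premises of \<open>starL\<close> at
    once.\<close>
  have pow: "map ante (replicate n A) \<in> kstar (value_of F A)" for n
  proof -
    have "map ante (replicate n A) = concat (replicate n [ante A])"
      by (induction n) simp_all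
    moreover have "set (replicate n [ante A]) \<subseteq> value_of F A"
      using Star by auto
    ultimately show ?thesis
      unfolding kstar_def by blast
  qed
  case 1 show ?case
    unfolding interp.simps
    by (rule ante_cl[OF pow], rule refuted, rule rule_step.starL) (use pow in blast)
  case 2
  have "kstar (value_of F A) \<subseteq> kstar (deriving F A)"
    using Star by (auto simp: kstar_def)
  then show ?case
    unfolding interp.simps using kstar_deriving by (intro cl_least deriving_concept) blast
qed

text \<open>\<open>zero_ideal\<close> bounds the products from above. From below, they contain the
  antecedent word of \<open>[Bot, Bot]\<close>, so their closures include the zero; the unit does so
  through the empty word.\<close>

lemma local_zero_zero: "local_zero UNIV (lang F) (zero F)"
proof -
  have Bot2: "map ante [Bot, Bot] \<in> conc M N" if "zero F \<subseteq> M" "zero F \<subseteq> N" for M N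
    using concI[of "[ante Bot]" M "[ante Bot]" N] that Bot_in_zero by auto
  have "conc M (zero F) \<subseteq> zero F" "conc (zero F) M \<subseteq> zero F" for M
    using zero_ideal[of _ F _ "[]"] zero_ideal[of _ F "[]"] by (auto simp: conc_def)
  then show ?thesis
    unfolding local_zero_def unit_def
    by (intro conjI ballI impI equalityI cl_least zero_concept zero_subset_cl[of "[]"]
        zero_subset_cl[OF Bot2]) simp_all
qed

lemma refuting_model: "SCL_model UNIV (lang F) (zero F) (\<lambda>p. deriving F (Var p))"
proof -
  have "zero F \<subseteq> deriving F (Var p)" for p
    using zero_subset[OF deriving_concept, of "[Var p]"] value_bounds(1)[of "Var p"] by simp
  then show ?thesis
    by (simp add: SCL_model_def local_zero_zero cone_def deriving_concept)
qed

section \<open>Truth in the model and weak completeness\<close>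

lemma foldl_fuse_mem:
  "v \<in> M \<Longrightarrow> v @ map ante \<Gamma> \<in> foldl (fuse UNIV (lang F)) M (map (value_of F) \<Gamma>)"
proof (induction \<Gamma> arbitrary: v M)
  case Nil
  then show ?case by simp
next
  case (Cons A \<Gamma>)
  have "v @ [ante A] \<in> conc M (value_of F A)"
    using Cons.prems value_bounds(1) by (rule concI)
  then have "v @ [ante A] \<in> fuse UNIV (lang F) M (value_of F A)"
    using subset_cl[of _ UNIV "lang F"] by (auto simp: fuse_def)
  from Cons.IH[OF this] show ?case by simp
qed

text \<open>The word \<open>map ante \<Gamma>\<close> is the witness: it lies in the product of the
  antecedent values, so truth places it in the value of \<open>B\<close>, which is included in
  \<open>deriving F B\<close>.\<close>

lemma true_in_not_refuted:
  assumes "true_in UNIV (lang F) (zero F) (\<lambda>p. deriving F (Var p)) \<Gamma> B"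
  shows "(\<Gamma>, B) \<notin> F"
proof -
  have "map ante \<Gamma> \<in> value_of F B"
  proof (cases \<Gamma>)
    case Nil
    then show ?thesis using assms by simp
  next
    case (Cons A \<Delta>)
    then show ?thesis
      using assms foldl_fuse_mem[OF value_bounds(1), of A \<Delta>] by auto
  qed
  then show ?thesis
    using value_bounds(2) map_ante_deriving by blast
qed

end

theorem theorem4:
  fixes \<Gamma> :: "form list" and B :: form
  assumes "\<And>(\<Sigma> :: nat set) L Z \<nu>.
    SCL_model \<Sigma> L Z \<nu> \<Longrightarrow> finite (cone \<Sigma> L Z) \<Longrightarrow> true_in \<Sigma> L Z \<nu> \<Gamma> B"
  shows "\<Gamma> \<turnstile> B"
proof (rule ccontr)
  assume "\<not> \<Gamma> \<turnstile> B"
  then obtain F where F: "finite F" "refutation F" "(\<Gamma>, B) \<in> F"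
    using finite_refutation by blast
  \<comment> \<open>\<open>[Bot]\<close> provides the antecedent word in the zero that
    \<open>finite_cone\<close> asks for.\<close>
  have "finite (cone UNIV (lang F) (zero F))"
    using F finite_cone[of F "[Bot]"] Bot_in_zero by simp
  then show False
    using F assms refuting_model true_in_not_refuted by blast
qed

end
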